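(* Let $\mathbf{k}$ be a field of characteristic not equal to $2$, let $(A,\cdot)$ be a $\mathbf{k}$-algebra with finite $\mathbf{k}$-dimension and let $r\in A\otimes A$, identified with a linear map $r:A^*\to A$. (i) $r$ is a solution of the associative Yang-Baxter equation in $A$ if and only if $$r(a^* )\cdot r(b^* )=r\big(R^*(r(a^* ))b^*-a^*L^*(r^t(b^* ))\big)\qquad\text{for all }a^*,b^*\in A^*.$$ (ii) Let $\alpha=(r-r^t)/2$ and $\beta=(r+r^t)/2$, and suppose that the symmetric part $\beta$ of $r$ is invariant. Let $\kappa\in\mathbf{k}$. Then $r$ is a solution of the extended associative Yang-Baxter equation of mass $\frac{\kappa+1}{4}$, $$r_{12}r_{13}+r_{13}r_{23}-r_{23}r_{12}=\tfrac{\kappa+1}{4}(r_{13}+r_{31})(r_{23}+r_{32}),$$ if and only if $\alpha$ is an extended $\mathcal{O}$-operator with modification $\beta$ of mass $\kappa$ (associated to the bimodule $(A^*,R^*,L^* )$), that is, $$\alpha(a^* )\cdot\alpha(b^* )-\alpha\big(R^*(\alpha(a^* ))b^*+a^*L^*(\alpha(b^* ))\big)=\kappa\,\beta(a^* )\cdot\beta(b^* )\qquad\text{for all }a^*,b^*\in A^*.$$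
   Context: A $\mathbf{k}$-algebra is an associative, not necessarily unital, algebra over $\mathbf{k}$. For $x\in A$: $L(x)y=xy$, $yR(x)=yx$. $(A^*,R^*,L^* )$ is the $A$-bimodule $A^*=\mathrm{Hom}_{\mathbf{k}}(A,\mathbf{k})$ with left action $\langle R^*(x)a^*,y\rangle=\langle a^*,yx\rangle$ and right action $\langle a^*L^*(x),y\rangle=\langle a^*,xy\rangle$. An element $r=\sum_i a_i\otimes b_i\in A\otimes A$ is identified with the linear map $r:A^*\to A$ with $\langle v,r(u)\rangle=\langle u\otimes v,r\rangle$, i.e. $r(u)=\sum_i\langle u,a_i\rangle b_i$; and $r^t:A^*\to A$ is given by $\langle u,r^t(v)\rangle=\langle u\otimes v,r\rangle$, i.e. $r^t(v)=\sum_i\langle v,b_i\rangle a_i$. Linear maps $A^*\to A$ are conversely regarded as elements of $A\otimes A$. Put $r_{12}r_{13}=\sum_{i,j}a_ia_j\otimes b_i\otimes b_j$, $r_{13}r_{23}=\sum_{i,j}a_i\otimes a_j\otimes b_ib_j$, $r_{23}r_{12}=\sum_{i,j}a_i\otimes a_jb_i\otimes b_j$; and, writing $r+\sigma(r)=\sum_i c_i\otimes d_i$ with $\sigma(a\otimes b)=b\otimes a$, $(r_{13}+r_{31})(r_{23}+r_{32})=\sum_{i,j}c_i\otimes c_j\otimes d_id_j$. The associative Yang-Baxter equation (AYBE) is $r_{12}r_{13}+r_{13}r_{23}-r_{23}r_{12}=0$. The extended associative Yang-Baxter equation of mass $\varepsilon\in\mathbf{k}$ is $r_{12}r_{13}+r_{13}r_{23}-r_{23}r_{12}=\varepsilon(r_{13}+r_{31})(r_{23}+r_{32})$.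 An element $s=\sum_i s_i\otimes t_i\in A\otimes A$ is invariant if $(\mathrm{id}\otimes L(x)-R(x)\otimes\mathrm{id})s=\sum_i(s_i\otimes xt_i-s_ix\otimes t_i)=0$ for all $x\in A$. (For symmetric $\beta$, invariance is equivalent to $\beta:A^*\to A$ being an $A$-bimodule homomorphism and to $R^*(\beta(a^* ))b^*=a^*L^*(\beta(b^* ))$ for all $a^*,b^*$, so $\beta$ is a legitimate modification of any mass.) *)

theory Defs
  imports Complex_Main "HOL-Library.Function_Algebras"
begin

section \<open>Algebras, dual spaces and the dual bimodule\<close>

text \<open>Associativity and distributivity are those of the (not necessarily unital) class \<open>ring\<close>.\<close>

locale assoc_algebra = vector_space scale
  for scale :: "'k::field \<Rightarrow> 'a::ring \<Rightarrow> 'a" +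
  assumes scale_mult_left: "scale c x * y = scale c (x * y)"
    and scale_mult_right: "x * scale c y = scale c (x * y)"

definition dual_space :: "('k::field \<Rightarrow> 'a::ab_group_add \<Rightarrow> 'a) \<Rightarrow> ('a \<Rightarrow> 'k) set" where
  "dual_space scale = {u. Vector_Spaces.linear scale (*) u}"

text \<open>The right action is written \<open>a\<^sup>* L\<^sup>*(x)\<close> on paper, hence the order of its arguments here.\<close>

definition Rstar :: "'a::ring \<Rightarrow> ('a \<Rightarrow> 'k) \<Rightarrow> 'a \<Rightarrow> 'k" where
  "Rstar x u = (\<lambda>y. u (y * x))"

definition Lstar :: "('a \<Rightarrow> 'k) \<Rightarrow> 'a::ring \<Rightarrow> 'a \<Rightarrow> 'k" where
  "Lstar u x = (\<lambda>y. u (x * y))"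


section \<open>Tensor powers\<close>

text \<open>
  The tensor \<open>a \<otimes> b\<close> is the functional ``evaluation at \<open>(a, b)\<close>'' on the space of bilinear forms, and
  \<open>A \<otimes> A\<close> is the linear span of these functionals, inside a function space whose addition is
  pointwise and whose scalar multiplication is \<open>fun_scale\<close>.  The universal property of this
  construction is proved below. The triple tensor product is built in the same way
  from trilinear forms.
\<close>

definition fun_scale :: "'k::field \<Rightarrow> ('x \<Rightarrow> 'k) \<Rightarrow> 'x \<Rightarrow> 'k" where
  "fun_scale c t = (\<lambda>x. c * t x)"

definition bilinear_map ::
  "('k::field \<Rightarrow> 'a::ab_group_add \<Rightarrow> 'a) \<Rightarrow> ('k \<Rightarrow> 'v::ab_group_add \<Rightarrow> 'v) \<Rightarrow> ('a \<Rightarrow> 'a \<Rightarrow> 'v) \<Rightarrow> bool" where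
  "bilinear_map scale s f \<longleftrightarrow>
     (\<forall>b. Vector_Spaces.linear scale s (\<lambda>a. f a b)) \<and>
     (\<forall>a. Vector_Spaces.linear scale s (\<lambda>b. f a b))"

definition trilinear_map ::
  "('k::field \<Rightarrow> 'a::ab_group_add \<Rightarrow> 'a) \<Rightarrow> ('k \<Rightarrow> 'v::ab_group_add \<Rightarrow> 'v) \<Rightarrow> ('a \<Rightarrow> 'a \<Rightarrow> 'a \<Rightarrow> 'v) \<Rightarrow> bool" where
  "trilinear_map scale s f \<longleftrightarrow>
     (\<forall>b c. Vector_Spaces.linear scale s (\<lambda>a. f a b c)) \<and>
     (\<forall>a c. Vector_Spaces.linear scale s (\<lambda>b. f a b c)) \<and>
     (\<forall>a b. Vector_Spaces.linear scale s (\<lambda>c. f a b c))"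

type_synonym ('a, 'k) tensor2 = "('a \<Rightarrow> 'a \<Rightarrow> 'k) \<Rightarrow> 'k"
type_synonym ('a, 'k) tensor3 = "('a \<Rightarrow> 'a \<Rightarrow> 'a \<Rightarrow> 'k) \<Rightarrow> 'k"

context
  fixes scale :: "'k::field \<Rightarrow> 'a::ring \<Rightarrow> 'a"
begin

definition tensor :: "'a \<Rightarrow> 'a \<Rightarrow> ('a, 'k) tensor2" where
  "tensor a b = (\<lambda>B. if bilinear_map scale (*) B then B a b else 0)"

definition ttensor :: "'a \<Rightarrow> 'a \<Rightarrow> 'a \<Rightarrow> ('a, 'k) tensor3" where
  "ttensor a b c = (\<lambda>T. if trilinear_map scale (*) T then T a b c else 0)"

definition tensor_square :: "('a, 'k) tensor2 set" where
  "tensor_square = module.span fun_scale {tensor a b |a b. True}"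

definition tensor_cube :: "('a, 'k) tensor3 set" where
  "tensor_cube = module.span fun_scale {ttensor a b c |a b c. True}"

text \<open>
  A list of pairs \<open>(a\<^sub>i, b\<^sub>i)\<close> with \<open>r = \<Sum>\<^sub>i a\<^sub>i \<otimes> b\<^sub>i\<close>.  All operations below are defined by such a
  representation, and lemmas \<open>*_eq\<close> show that they do not depend on its choice.
\<close>

definition tensor_repr :: "('a, 'k) tensor2 \<Rightarrow> ('a \<times> 'a) list" where
  "tensor_repr r = (SOME ps. r = (\<Sum>(a, b)\<leftarrow>ps. tensor a b))"

definition flip :: "('a, 'k) tensor2 \<Rightarrow> ('a, 'k) tensor2" where
  "flip r = (\<Sum>(a, b)\<leftarrow>tensor_repr r. tensor b a)"

text \<open>The maps \<open>r\<close> and \<open>r\<^sup>t\<close> from \<open>A\<^sup>*\<close> to \<open>A\<close>.\<close>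

definition tensor_map :: "('a, 'k) tensor2 \<Rightarrow> ('a \<Rightarrow> 'k) \<Rightarrow> 'a" where
  "tensor_map r u = (\<Sum>(a, b)\<leftarrow>tensor_repr r. scale (u a) b)"

definition tensor_map_t :: "('a, 'k) tensor2 \<Rightarrow> ('a \<Rightarrow> 'k) \<Rightarrow> 'a" where
  "tensor_map_t r v = (\<Sum>(a, b)\<leftarrow>tensor_repr r. scale (v b) a)"

definition r12_r13 :: "('a, 'k) tensor2 \<Rightarrow> ('a, 'k) tensor3" where
  "r12_r13 r = (\<Sum>(a, b)\<leftarrow>tensor_repr r. \<Sum>(a', b')\<leftarrow>tensor_repr r. ttensor (a * a') b b')"

definition r13_r23 :: "('a, 'k) tensor2 \<Rightarrow> ('a, 'k) tensor3" where
  "r13_r23 r = (\<Sum>(a, b)\<leftarrow>tensor_repr r. \<Sum>(a', b')\<leftarrow>tensor_repr r. ttensor a a' (b * b'))"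

definition r23_r12 :: "('a, 'k) tensor2 \<Rightarrow> ('a, 'k) tensor3" where
  "r23_r12 r = (\<Sum>(a, b)\<leftarrow>tensor_repr r. \<Sum>(a', b')\<leftarrow>tensor_repr r. ttensor a (a' * b) b')"

text \<open>Here \<open>r + flip r\<close> plays the role of \<open>\<Sum>\<^sub>i c\<^sub>i \<otimes> d\<^sub>i\<close>.\<close>

definition r13_r31_r23_r32 :: "('a, 'k) tensor2 \<Rightarrow> ('a, 'k) tensor3" where
  "r13_r31_r23_r32 r =
     (\<Sum>(c, d)\<leftarrow>tensor_repr (r + flip r). \<Sum>(c', d')\<leftarrow>tensor_repr (r + flip r). ttensor c c' (d * d'))"

definition AYBE :: "('a, 'k) tensor2 \<Rightarrow> bool" where
  "AYBE r \<longleftrightarrow> r12_r13 r + r13_r23 r - r23_r12 r = 0"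

definition extended_AYBE :: "'k \<Rightarrow> ('a, 'k) tensor2 \<Rightarrow> bool" where
  "extended_AYBE \<epsilon> r \<longleftrightarrow>
     r12_r13 r + r13_r23 r - r23_r12 r = fun_scale \<epsilon> (r13_r31_r23_r32 r)"

definition invariant_tensor :: "('a, 'k) tensor2 \<Rightarrow> bool" where
  "invariant_tensor s \<longleftrightarrow>
     (\<forall>x. (\<Sum>(a, b)\<leftarrow>tensor_repr s. tensor a (x * b) - tensor (a * x) b) = 0)"

text \<open>
  The bimodule is \<open>(A\<^sup>*, R\<^sup>*, L\<^sup>*)\<close>.  The requirement that the modification \<open>\<beta>\<close> be an
  \<open>A\<close>-bimodule homomorphism with \<open>R\<^sup>*(\<beta>(a\<^sup>*)) b\<^sup>* = a\<^sup>* L\<^sup>*(\<beta>(b\<^sup>*))\<close> is not part of this predicate: for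
  the map of a symmetric tensor it is equivalent to \<open>invariant_tensor\<close>.
\<close>

definition extended_O_operator :: "(('a \<Rightarrow> 'k) \<Rightarrow> 'a) \<Rightarrow> (('a \<Rightarrow> 'k) \<Rightarrow> 'a) \<Rightarrow> 'k \<Rightarrow> bool" where
  "extended_O_operator \<alpha> \<beta> \<kappa> \<longleftrightarrow>
     (\<forall>u\<in>dual_space scale. \<forall>v\<in>dual_space scale.
        \<alpha> u * \<alpha> v - \<alpha> (Rstar (\<alpha> u) v + Lstar u (\<alpha> v)) = scale \<kappa> (\<beta> u * \<beta> v))"

end


section \<open>Adequacy of the construction\<close>

lemma vector_space_fun_scale: "vector_space (fun_scale :: 'k::field \<Rightarrow> ('x \<Rightarrow> 'k) \<Rightarrow> 'x \<Rightarrow> 'k)"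
  by unfold_locales (auto simp: fun_scale_def fun_eq_iff algebra_simps)

lemma vector_space_times: "vector_space ((*) :: 'k::field \<Rightarrow> 'k \<Rightarrow> 'k)"
  by unfold_locales (auto simp: algebra_simps)

lemma linear_sum_list_apply:
  assumes "Vector_Spaces.linear s1 s2 g"
  shows "g (\<Sum>(a, b)\<leftarrow>ps. f a b) = (\<Sum>(a, b)\<leftarrow>ps. g (f a b))"
proof -
  interpret Vector_Spaces.linear s1 s2 g by fact
  show ?thesis by (induction ps) (auto simp: add)
qed

lemma linear_functional_separates:
  fixes s :: "'k::field \<Rightarrow> 'v::ab_group_add \<Rightarrow> 'v"
  assumes "vector_space s" and "\<And>g. Vector_Spaces.linear s (*) g \<Longrightarrow> g x = g y"
  shows "x = y"
proof (rule ccontr)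
  assume "x \<noteq> y"
  interpret vector_space s by fact
  interpret vp: vector_space_pair s "(*) :: 'k \<Rightarrow> 'k \<Rightarrow> 'k"
    by (intro vector_space_pair.intro vector_space_times assms(1))
  have "independent {x - y}" using \<open>x \<noteq> y\<close> by simp
  from vp.linear_independent_extend[OF this, of "\<lambda>_. 1"]
  obtain g where g: "Vector_Spaces.linear s (*) g" "g (x - y) = 1" by auto
  have "g (x - y) = g x - g y" by (rule vp.linear_diff[OF g(1)])
  with g assms(2)[OF g(1)] show False by simp
qed

lemma bilinear_map_tensor:
  assumes "vector_space scale" shows "bilinear_map scale fun_scale (tensor scale)"
  using assms vector_space_fun_scale
  by (auto simp: bilinear_map_def Vector_Spaces.linear_iff tensor_def fun_scale_def fun_eq_iff)

lemma trilinear_map_ttensor: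
  assumes "vector_space scale" shows "trilinear_map scale fun_scale (ttensor scale)"
  using assms vector_space_fun_scale
  by (auto simp: trilinear_map_def Vector_Spaces.linear_iff ttensor_def fun_scale_def fun_eq_iff)

lemma tensor_square_repr:
  assumes "vector_space scale" and "r \<in> tensor_square scale"
  shows "r = (\<Sum>(a, b)\<leftarrow>tensor_repr scale r. tensor scale a b)"
proof -
  interpret F: vector_space "fun_scale :: 'a \<Rightarrow> _ \<Rightarrow> ('b, 'a) tensor2" by (rule vector_space_fun_scale)
  have "\<exists>ps. r = (\<Sum>(a, b)\<leftarrow>ps. tensor scale a b)"
    using assms(2) unfolding tensor_square_def
  proof (induction rule: F.span_induct_alt)
    case base
    show ?case by (rule exI[of _ "[]"]) simp
  next
    case (step c x y)
    then obtain a b ps where "x = tensor scale a b" "y = (\<Sum>(a, b)\<leftarrow>ps. tensor scale a b)" by blast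
    moreover have "fun_scale c (tensor scale a b) = tensor scale (scale c a) b"
      using bilinear_map_tensor[OF assms(1)] by (simp add: bilinear_map_def Vector_Spaces.linear_iff)
    ultimately show ?case by (intro exI[of _ "(scale c a, b) # ps"]) simp
  qed
  then show ?thesis unfolding tensor_repr_def by (rule someI_ex)
qed

lemma sum_tensor_in_tensor_square:
  "(\<Sum>(a, b)\<leftarrow>ps. tensor scale a b) \<in> tensor_square scale"
proof -
  interpret F: vector_space "fun_scale :: 'b \<Rightarrow> _ \<Rightarrow> ('a, 'b) tensor2" by (rule vector_space_fun_scale)
  show ?thesis unfolding tensor_square_def
  proof (induction ps)
    case Nil
    show ?case by (simp only: list.map sum_list.Nil F.span_zero)
  next
    case (Cons p ps)
    obtain a b where "p = (a, b)" by fastforce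
    moreover have "tensor scale a b \<in> F.span {tensor scale a b |a b. True}"
      by (rule F.span_base) blast
    ultimately show ?case using F.span_add[OF _ Cons] by (simp only: list.map sum_list.Cons prod.case)
  qed
qed

lemma tensor_sum_cong:
  assumes "vector_space s" and f: "bilinear_map scale s f"
    and eq: "(\<Sum>(a, b)\<leftarrow>ps. tensor scale a b) = (\<Sum>(a, b)\<leftarrow>qs. tensor scale a b)"
  shows "(\<Sum>(a, b)\<leftarrow>ps. f a b) = (\<Sum>(a, b)\<leftarrow>qs. f a b)"
proof (rule linear_functional_separates[OF assms(1)])
  fix g assume g: "Vector_Spaces.linear s (*) g"
  have B: "bilinear_map scale (*) (\<lambda>a b. g (f a b))"
    using f g by (simp add: bilinear_map_def Vector_Spaces.linear_iff)
  have "(\<Sum>(a, b)\<leftarrow>ps. tensor scale a b) (\<lambda>a b. g (f a b)) = (\<Sum>(a, b)\<leftarrow>ps. g (f a b))" for ps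
    using B by (induction ps) (auto simp: tensor_def)
  with eq show "g (\<Sum>(a, b)\<leftarrow>ps. f a b) = g (\<Sum>(a, b)\<leftarrow>qs. f a b)"
    by (metis linear_sum_list_apply[OF g])
qed

text \<open>
  The universal properties.  The linear map is unique on \<open>tensor_square\<close> and \<open>tensor_cube\<close> because
  these are spanned by the pure tensors.
\<close>

lemma spanned_by_functionals_extension:
  fixes f :: "'i \<Rightarrow> 'v::ab_group_add" and t :: "'i \<Rightarrow> 'x \<Rightarrow> 'k::field"
  assumes "vector_space s"
    and ev: "\<And>g. Vector_Spaces.linear s (*) g \<Longrightarrow> \<exists>x. \<forall>i. t i x = g (f i)"
  shows "\<exists>F. Vector_Spaces.linear fun_scale s F \<and> (\<forall>i. F (t i) = f i)"
proof -
  interpret vector_space s by fact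
  interpret vp: vector_space_pair "fun_scale :: 'k \<Rightarrow> _ \<Rightarrow> 'x \<Rightarrow> 'k" s
    by (intro vector_space_pair.intro vector_space_fun_scale assms(1))
  interpret vk: vector_space_pair "fun_scale :: 'k \<Rightarrow> _ \<Rightarrow> 'x \<Rightarrow> 'k" "(*) :: 'k \<Rightarrow> 'k \<Rightarrow> 'k"
    by (intro vector_space_pair.intro vector_space_fun_scale vector_space_times)
  obtain B where B: "B \<subseteq> range t" "vp.vs1.independent B" "range t \<subseteq> vp.vs1.span B"
    using vp.vs1.maximal_independent_subset[of "range t"] by blast
  obtain F where F: "Vector_Spaces.linear fun_scale s F" "\<forall>x\<in>B. F x = f (inv t x)"
    using vp.linear_independent_extend[OF B(2), of "\<lambda>x. f (inv t x)"] by blast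
  have "F (t i) = f i" for i
  proof (rule linear_functional_separates[OF assms(1)])
    fix g assume g: "Vector_Spaces.linear s (*) g"
    then obtain x where x: "\<forall>i. t i x = g (f i)" using ev by blast
    have gF: "Vector_Spaces.linear fun_scale (*) (\<lambda>u. g (F u))"
      using g F(1) by (simp add: Vector_Spaces.linear_iff)
    have E: "Vector_Spaces.linear fun_scale (*) (\<lambda>u :: 'x \<Rightarrow> 'k. u x)"
      using vector_space_fun_scale vector_space_times by (simp add: Vector_Spaces.linear_iff fun_scale_def)
    have "g (F u) = u x" if "u \<in> B" for u
      using that F(2) B(1) x by (metis f_inv_into_f subsetD)
    then have "g (F (t i)) = t i x"
      using vk.linear_eq_on[OF gF E, of "t i" B] B(3) by blast
    with x show "g (F (t i)) = g (f i)" by simp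
  qed
  with F(1) show ?thesis by blast
qed

lemma tensor_universal:
  assumes "vector_space s" and f: "bilinear_map scale s f"
  shows "\<exists>F. Vector_Spaces.linear fun_scale s F \<and> (\<forall>a b. F (tensor scale a b) = f a b)"
proof -
  have "\<exists>x. \<forall>i. (\<lambda>(a, b). tensor scale a b) i x = g ((\<lambda>(a, b). f a b) i)"
    if "Vector_Spaces.linear s (*) g" for g
    using f that
    by (intro exI[of _ "\<lambda>a b. g (f a b)"]) (auto simp: bilinear_map_def Vector_Spaces.linear_iff tensor_def)
  from spanned_by_functionals_extension[OF assms(1) this] show ?thesis by fastforce
qed

lemma ttensor_universal:
  assumes "vector_space s" and f: "trilinear_map scale s f"
  shows "\<exists>F. Vector_Spaces.linear fun_scale s F \<and> (\<forall>a b c. F (ttensor scale a b c) = f a b c)"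
proof -
  have "\<exists>x. \<forall>i. (\<lambda>(a, b, c). ttensor scale a b c) i x = g ((\<lambda>(a, b, c). f a b c) i)"
    if "Vector_Spaces.linear s (*) g" for g
    using f that
    by (intro exI[of _ "\<lambda>a b c. g (f a b c)"]) (auto simp: trilinear_map_def Vector_Spaces.linear_iff ttensor_def)
  from spanned_by_functionals_extension[OF assms(1) this] show ?thesis by fastforce
qed

text \<open>Independence of the chosen representation.\<close>

lemma bilinear_map_sum_list:
  assumes "vector_space scale" "vector_space s" and "\<And>x y. bilinear_map scale s (\<lambda>a b. f a b x y)"
  shows "bilinear_map scale s (\<lambda>a b. \<Sum>(x, y)\<leftarrow>qs. f a b x y)"
proof -
  interpret vector_space s by fact
  show ?thesis
    using assms by (induction qs) (auto simp: bilinear_map_def Vector_Spaces.linear_iff scale_right_distrib add_ac)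
qed

context assoc_algebra
begin

lemma tensor_repr_sum:
  "(\<Sum>(a, b)\<leftarrow>tensor_repr scale (\<Sum>(a, b)\<leftarrow>ps. tensor scale a b). tensor scale a b) =
   (\<Sum>(a, b)\<leftarrow>ps. tensor scale a b)"
  using tensor_square_repr[OF vector_space_axioms sum_tensor_in_tensor_square] by simp

lemma tensor_sum_eq:
  assumes "vector_space s" and "bilinear_map scale s f" and "r = (\<Sum>(a, b)\<leftarrow>ps. tensor scale a b)"
  shows "(\<Sum>(a, b)\<leftarrow>tensor_repr scale r. f a b) = (\<Sum>(a, b)\<leftarrow>ps. f a b)"
  using tensor_sum_cong[OF assms(1,2) tensor_repr_sum] assms(3) by simp

lemma tensor_double_sum_eq:
  assumes s: "vector_space s"
    and f1: "\<And>a b. bilinear_map scale s (\<lambda>a' b'. f a b a' b')"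
    and f2: "\<And>a' b'. bilinear_map scale s (\<lambda>a b. f a b a' b')"
    and r: "r = (\<Sum>(a, b)\<leftarrow>ps. tensor scale a b)"
  shows "(\<Sum>(a, b)\<leftarrow>tensor_repr scale r. \<Sum>(a', b')\<leftarrow>tensor_repr scale r. f a b a' b') =
         (\<Sum>(a, b)\<leftarrow>ps. \<Sum>(a', b')\<leftarrow>ps. f a b a' b')"
  unfolding tensor_sum_eq[OF s f1 r]
  by (rule tensor_sum_eq[OF s bilinear_map_sum_list[OF vector_space_axioms s f2] r])

lemmas ttensor_rules =
  trilinear_map_ttensor[OF vector_space_axioms, unfolded trilinear_map_def Vector_Spaces.linear_iff]

lemma flip_eq:
  assumes "r = (\<Sum>(a, b)\<leftarrow>ps. tensor scale a b)"
  shows "flip scale r = (\<Sum>(a, b)\<leftarrow>ps. tensor scale b a)"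
  unfolding flip_def
  by (rule tensor_sum_eq[OF vector_space_fun_scale _ assms])
    (use bilinear_map_tensor[OF vector_space_axioms] in \<open>auto simp: bilinear_map_def\<close>)

lemma tensor_map_eq:
  assumes "r = (\<Sum>(a, b)\<leftarrow>ps. tensor scale a b)" and "u \<in> dual_space scale"
  shows "tensor_map scale r u = (\<Sum>(a, b)\<leftarrow>ps. scale (u a) b)"
  unfolding tensor_map_def
  by (rule tensor_sum_eq[OF vector_space_axioms _ assms(1)])
    (use assms(2) in \<open>auto simp: dual_space_def bilinear_map_def Vector_Spaces.linear_iff algebra_simps\<close>)

lemma tensor_map_t_eq:
  assumes "r = (\<Sum>(a, b)\<leftarrow>ps. tensor scale a b)" and "v \<in> dual_space scale"
  shows "tensor_map_t scale r v = (\<Sum>(a, b)\<leftarrow>ps. scale (v b) a)"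
  unfolding tensor_map_t_def
  by (rule tensor_sum_eq[OF vector_space_axioms _ assms(1)])
    (use assms(2) in \<open>auto simp: dual_space_def bilinear_map_def Vector_Spaces.linear_iff algebra_simps\<close>)

lemma r12_r13_eq:
  assumes "r = (\<Sum>(a, b)\<leftarrow>ps. tensor scale a b)"
  shows "r12_r13 scale r = (\<Sum>(a, b)\<leftarrow>ps. \<Sum>(a', b')\<leftarrow>ps. ttensor scale (a * a') b b')"
  unfolding r12_r13_def
  by (rule tensor_double_sum_eq[OF vector_space_fun_scale _ _ assms])
    (use ttensor_rules in \<open>auto simp: bilinear_map_def Vector_Spaces.linear_iff distrib_left distrib_right
      scale_mult_left scale_mult_right\<close>)

lemma r13_r23_eq:
  assumes "r = (\<Sum>(a, b)\<leftarrow>ps. tensor scale a b)"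
  shows "r13_r23 scale r = (\<Sum>(a, b)\<leftarrow>ps. \<Sum>(a', b')\<leftarrow>ps. ttensor scale a a' (b * b'))"
  unfolding r13_r23_def
  by (rule tensor_double_sum_eq[OF vector_space_fun_scale _ _ assms])
    (use ttensor_rules in \<open>auto simp: bilinear_map_def Vector_Spaces.linear_iff distrib_left distrib_right
      scale_mult_left scale_mult_right\<close>)

lemma r23_r12_eq:
  assumes "r = (\<Sum>(a, b)\<leftarrow>ps. tensor scale a b)"
  shows "r23_r12 scale r = (\<Sum>(a, b)\<leftarrow>ps. \<Sum>(a', b')\<leftarrow>ps. ttensor scale a (a' * b) b')"
  unfolding r23_r12_def
  by (rule tensor_double_sum_eq[OF vector_space_fun_scale _ _ assms])
    (use ttensor_rules in \<open>auto simp: bilinear_map_def Vector_Spaces.linear_iff distrib_left distrib_right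
      scale_mult_left scale_mult_right\<close>)

lemma r13_r31_r23_r32_eq:
  assumes "r + flip scale r = (\<Sum>(c, d)\<leftarrow>ps. tensor scale c d)"
  shows "r13_r31_r23_r32 scale r = (\<Sum>(c, d)\<leftarrow>ps. \<Sum>(c', d')\<leftarrow>ps. ttensor scale c c' (d * d'))"
  using r13_r23_eq[OF assms] by (simp add: r13_r23_def r13_r31_r23_r32_def)

lemma invariant_tensor_eq:
  assumes "s = (\<Sum>(a, b)\<leftarrow>ps. tensor scale a b)"
  shows "invariant_tensor scale s \<longleftrightarrow>
    (\<forall>x. (\<Sum>(a, b)\<leftarrow>ps. tensor scale a (x * b) - tensor scale (a * x) b) = 0)"
proof -
  note rules = bilinear_map_tensor[OF vector_space_axioms, unfolded bilinear_map_def Vector_Spaces.linear_iff]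
  have "(\<Sum>(a, b)\<leftarrow>tensor_repr scale s. tensor scale a (x * b) - tensor scale (a * x) b) =
        (\<Sum>(a, b)\<leftarrow>ps. tensor scale a (x * b) - tensor scale (a * x) b)" for x
    by (rule tensor_sum_eq[OF vector_space_fun_scale _ assms])
      (use rules in \<open>auto simp: bilinear_map_def Vector_Spaces.linear_iff distrib_left distrib_right
        scale_mult_left scale_mult_right fun_scale_def fun_eq_iff algebra_simps\<close>)
  then show ?thesis by (simp add: invariant_tensor_def)
qed

text \<open>
  The defining pairings of \<open>r\<close> and \<open>r\<^sup>t\<close>, and the compatibility of the identification of tensors
  with maps: as an element of \<open>A \<otimes> A\<close>, the map \<open>r\<^sup>t\<close> is \<open>flip r\<close>.
\<close>

lemma tensor_map_pairing:
  assumes r: "r \<in> tensor_square scale" and u: "u \<in> dual_space scale" and v: "v \<in> dual_space scale"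
  shows "v (tensor_map scale r u) = r (\<lambda>a b. u a * v b)"
    and "u (tensor_map_t scale r v) = r (\<lambda>a b. u a * v b)"
proof -
  have lu: "Vector_Spaces.linear scale (*) u" and lv: "Vector_Spaces.linear scale (*) v"
    using u v by (auto simp: dual_space_def)
  have B: "bilinear_map scale (*) (\<lambda>a b. u a * v b)"
    using lu lv by (simp add: bilinear_map_def Vector_Spaces.linear_iff algebra_simps)
  have "(\<Sum>(a, b)\<leftarrow>ps. tensor scale a b) (\<lambda>a b. u a * v b) = (\<Sum>(a, b)\<leftarrow>ps. u a * v b)" for ps
    using B by (induction ps) (auto simp: tensor_def)
  from this[of "tensor_repr scale r"] tensor_square_repr[OF vector_space_axioms r]
  have *: "r (\<lambda>a b. u a * v b) = (\<Sum>(a, b)\<leftarrow>tensor_repr scale r. u a * v b)" by simp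
  show "v (tensor_map scale r u) = r (\<lambda>a b. u a * v b)"
    unfolding * tensor_map_def linear_sum_list_apply[OF lv] using lv by (simp add: Vector_Spaces.linear_iff)
  show "u (tensor_map_t scale r v) = r (\<lambda>a b. u a * v b)"
    unfolding * tensor_map_t_def linear_sum_list_apply[OF lu] using lu
    by (simp add: Vector_Spaces.linear_iff mult.commute)
qed

lemma tensor_map_flip:
  assumes "r \<in> tensor_square scale" and "u \<in> dual_space scale"
  shows "tensor_map scale (flip scale r) u = tensor_map_t scale r u"
proof -
  let ?qs = "map (\<lambda>(a, b). (b, a)) (tensor_repr scale r)"
  have "flip scale r = (\<Sum>(a, b)\<leftarrow>?qs. tensor scale a b)"
    by (simp add: flip_def o_def case_prod_unfold)
  from tensor_map_eq[OF this assms(2)] show ?thesis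
    by (simp add: tensor_map_t_def o_def case_prod_unfold)
qed

lemma flip_in_tensor_square:
  shows "flip scale r \<in> tensor_square scale"
  using sum_tensor_in_tensor_square[of scale "map (\<lambda>(a, b). (b, a)) (tensor_repr scale r)"]
  by (simp add: flip_def o_def case_prod_unfold)

lemma tensor_map_symmetric_part:
  assumes r: "r \<in> tensor_square scale" and u: "u \<in> dual_space scale"
  shows "tensor_map scale (fun_scale c (r + flip scale r)) u =
      scale c (tensor_map scale r u + tensor_map_t scale r u)" (is ?thesis1)
    and "tensor_map scale (fun_scale c (r - flip scale r)) u =
      scale c (tensor_map scale r u - tensor_map_t scale r u)" (is ?thesis2)
proof -
  interpret F: vector_space "fun_scale :: 'k \<Rightarrow> _ \<Rightarrow> ('a, 'k) tensor2" by (rule vector_space_fun_scale)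
  have sub: "F.subspace (tensor_square scale)" unfolding tensor_square_def by (rule F.subspace_span)
  note fl = flip_in_tensor_square[of r]
  have in1: "fun_scale c (r + flip scale r) \<in> tensor_square scale"
    and in2: "fun_scale c (r - flip scale r) \<in> tensor_square scale"
    using sub r fl by (auto intro!: F.subspace_scale F.subspace_add F.subspace_diff)
  have ext: "x = y" if "\<And>v. v \<in> dual_space scale \<Longrightarrow> v x = v y" for x y
    by (rule linear_functional_separates[OF vector_space_axioms]) (use that in \<open>auto simp: dual_space_def\<close>)
  have lin: "v (scale c (x + y)) = c * (v x + v y)" "v (scale c (x - y)) = c * (v x - v y)"
    if v: "v \<in> dual_space scale" for v x y
  proof -
    interpret v: Vector_Spaces.linear scale "(*)" v using v by (simp add: dual_space_def)
    show "v (scale c (x + y)) = c * (v x + v y)" "v (scale c (x - y)) = c * (v x - v y)"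
      by (simp_all add: v.scale v.add v.diff)
  qed
  note pair = tensor_map_pairing(1)[OF _ u]
  have "v (tensor_map scale (fun_scale c (r + flip scale r)) u) =
      v (scale c (tensor_map scale r u + tensor_map_t scale r u))"
    and "v (tensor_map scale (fun_scale c (r - flip scale r)) u) =
      v (scale c (tensor_map scale r u - tensor_map_t scale r u))"
    if "v \<in> dual_space scale" for v
    unfolding lin[OF that] pair[OF in1 that] pair[OF in2 that] pair[OF r that]
      tensor_map_flip[OF r u, symmetric] pair[OF fl that]
    by (simp_all add: fun_scale_def)
  then show ?thesis1 ?thesis2 by (auto intro: ext)
qed

end

end

theory Submission
  imports Defs
begin

text \<open>
  In finite dimension an element of \<open>A \<otimes> A \<otimes> A\<close> is determined by its pairings with the decomposable
  functionals \<open>u \<otimes> v \<otimes> w\<close>.  The pairing of \<open>r\<^sub>1\<^sub>2r\<^sub>1\<^sub>3 + r\<^sub>1\<^sub>3r\<^sub>2\<^sub>3 - r\<^sub>2\<^sub>3r\<^sub>1\<^sub>2\<close> is \<open>w\<close> applied to the difference of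
  the two sides of (i).  For (ii) substitute \<open>r = \<alpha> + \<beta>\<close> and \<open>r\<^sup>t = \<beta> - \<alpha>\<close>: invariance makes \<open>\<beta>\<close> a
  bimodule homomorphism with \<open>R\<^sup>*(\<beta>(u)) v = u L\<^sup>*(\<beta>(v))\<close>, so all mixed terms cancel and only
  \<open>\<beta>(u) \<beta>(v)\<close> remains, which accounts for the shift from \<open>\<kappa>\<close> to \<open>\<kappa> + 1\<close>; the extended right-hand
  side contributes \<open>(2\<beta>(u)) (2\<beta>(v))\<close>, hence the factor \<open>1/4\<close>.
\<close>

section \<open>Finite sums over lists of pairs\<close>

lemma sum_list_pairs_apply:
  "(\<Sum>(a, b)\<leftarrow>ps. f a b) x = (\<Sum>(a, b)\<leftarrow>ps. f a b x)"
  by (induction ps) auto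

lemma sum_list_pairs_const_mult:
  fixes k :: "'a::semiring_0"
  shows "(\<Sum>(a, b)\<leftarrow>ps. f a b) * k = (\<Sum>(a, b)\<leftarrow>ps. f a b * k)"
    and "k * (\<Sum>(a, b)\<leftarrow>ps. f a b) = (\<Sum>(a, b)\<leftarrow>ps. k * f a b)"
  by (induction ps) (auto simp: distrib_left distrib_right)

lemma sum_list_pairs_swap:
  fixes f :: "'a \<Rightarrow> 'b \<Rightarrow> 'c \<Rightarrow> 'd \<Rightarrow> 'e::comm_monoid_add"
  shows "(\<Sum>(a, b)\<leftarrow>ps. \<Sum>(c, d)\<leftarrow>qs. f a b c d) = (\<Sum>(c, d)\<leftarrow>qs. \<Sum>(a, b)\<leftarrow>ps. f a b c d)"
proof (induction ps)
  case (Cons p ps)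
  have "(\<Sum>(c, d)\<leftarrow>qs. g c d + h c d) = (\<Sum>(c, d)\<leftarrow>qs. g c d) + (\<Sum>(c, d)\<leftarrow>qs. h c d)"
    for g h :: "'c \<Rightarrow> 'd \<Rightarrow> 'e"
    by (induction qs) (auto simp: add_ac)
  with Cons show ?case by (cases p) simp
qed (induction qs; auto)

text \<open>Arbitrary entries \<open>f\<close>, \<open>g\<close>, \<open>h\<close> let one statement
  cover all three Yang-Baxter products.\<close>

lemma sum_ttensor_in_tensor_cube:
  "(\<Sum>(a, b)\<leftarrow>ps. \<Sum>(c, d)\<leftarrow>qs. ttensor scale (f a b c d) (g a b c d) (h a b c d)) \<in> tensor_cube scale"
proof -
  interpret F: vector_space "fun_scale :: 'k::field \<Rightarrow> _ \<Rightarrow> ('a::ring, 'k) tensor3"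
    by (rule vector_space_fun_scale)
  have list: "(\<Sum>(a, b)\<leftarrow>xs. t a b) \<in> F.span S" if "\<And>a b. t a b \<in> F.span S"
    for xs :: "('x \<times> 'y) list" and t and S
    using that by (induction xs) (auto intro: F.span_add simp: F.span_zero simp del: plus_fun_apply)
  show ?thesis
    unfolding tensor_cube_def by (intro list F.span_base) blast
qed

section \<open>Dual functionals and their bimodule actions\<close>

context assoc_algebra
begin

lemma dualD:
  assumes "u \<in> dual_space scale"
  shows "u (x + y) = u x + u y" "u (x - y) = u x - u y" "u (scale c x) = c * u x"
    "u (\<Sum>(a, b)\<leftarrow>ps. f a b) = (\<Sum>(a, b)\<leftarrow>ps. u (f a b))"
proof -
  interpret u: Vector_Spaces.linear scale "(*)" u using assms by (simp add: dual_space_def)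
  show "u (x + y) = u x + u y" "u (x - y) = u x - u y" "u (scale c x) = c * u x"
    by (simp_all add: u.add u.diff u.scale)
  show "u (\<Sum>(a, b)\<leftarrow>ps. f a b) = (\<Sum>(a, b)\<leftarrow>ps. u (f a b))"
    by (rule linear_sum_list_apply[OF u.linear_axioms])
qed

lemma dual_separates:
  assumes "\<And>w. w \<in> dual_space scale \<Longrightarrow> w x = w y"
  shows "x = y"
  by (rule linear_functional_separates[OF vector_space_axioms]) (use assms in \<open>auto simp: dual_space_def\<close>)

lemma dual_spaceI:
  assumes "\<And>x y. u (x + y) = u x + u y" "\<And>c x. u (scale c x) = c * u x"
  shows "u \<in> dual_space scale"
  using assms vector_space_axioms vector_space_times
  by (simp add: dual_space_def Vector_Spaces.linear_iff)

lemma Rstar_dual: "u \<in> dual_space scale \<Longrightarrow> Rstar x u \<in> dual_space scale"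
  by (rule dual_spaceI) (simp_all add: Rstar_def dualD distrib_right scale_mult_left)

lemma Lstar_dual: "u \<in> dual_space scale \<Longrightarrow> Lstar u x \<in> dual_space scale"
  by (rule dual_spaceI) (simp_all add: Lstar_def dualD distrib_left scale_mult_right)

text \<open>Both sides run over the same chosen list \<open>tensor_repr scale r\<close>, so the
  identity is termwise, for arbitrary functions \<open>u\<close> and \<open>v\<close>.\<close>

lemma tensor_map_add: "tensor_map scale r (u + v) = tensor_map scale r u + tensor_map scale r v"
proof -
  have "(\<Sum>(a, b)\<leftarrow>ps. scale ((u + v) a) b) = (\<Sum>(a, b)\<leftarrow>ps. scale (u a) b) + (\<Sum>(a, b)\<leftarrow>ps. scale (v a) b)" for ps
    by (induction ps) (auto simp: scale_left_distrib)
  then show ?thesis unfolding tensor_map_def .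
qed

lemma tensor_map_diff: "tensor_map scale r (u - v) = tensor_map scale r u - tensor_map scale r v"
  using tensor_map_add[of r "u - v" v] by (simp add: algebra_simps)

section \<open>Pairings with decomposable functionals, and their faithfulness in finite
  dimension\<close>

lemma sum_scale_mult:
  "(\<Sum>(a, b)\<leftarrow>ps. scale (f a b) (g a b)) * y = (\<Sum>(a, b)\<leftarrow>ps. scale (f a b) (g a b * y))"
  "x * (\<Sum>(a, b)\<leftarrow>ps. scale (f a b) (g a b)) = (\<Sum>(a, b)\<leftarrow>ps. scale (f a b) (x * g a b))"
  by (induction ps) (auto simp: distrib_left distrib_right scale_mult_left scale_mult_right)

lemma trilinear_map_dual:
  assumes "u \<in> dual_space scale" "v \<in> dual_space scale" "w \<in> dual_space scale"
  shows "trilinear_map scale (*) (\<lambda>a b c. u a * v b * w c)"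
  using vector_space_axioms vector_space_times assms
  by (simp add: trilinear_map_def Vector_Spaces.linear_iff dualD algebra_simps)

text \<open>The product sits in the third slot: weighting \<open>b\<close> by \<open>u a\<close> and
  \<open>b'\<close> by \<open>v a'\<close> assembles r(u) and r(v) inside \<open>w\<close>.\<close>

lemma r13_r23_pairing:
  assumes d: "u \<in> dual_space scale" "v \<in> dual_space scale" "w \<in> dual_space scale"
  shows "r13_r23 scale r (\<lambda>a b c. u a * v b * w c) = w (tensor_map scale r u * tensor_map scale r v)"
proof -
  let ?ps = "tensor_repr scale r"
  have "w (tensor_map scale r u * tensor_map scale r v)
      = (\<Sum>(a', b')\<leftarrow>?ps. \<Sum>(a, b)\<leftarrow>?ps. v a' * (u a * w (b * b')))"
    unfolding tensor_map_def sum_scale_mult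
    by (simp add: dualD[OF d(3)] sum_list_pairs_const_mult)
  \<comment> \<open>The expansion has the sum for the right factor outside; the exchange restores
    the order used in \<open>r13_r23\<close>.\<close>
  also have "\<dots> = (\<Sum>(a, b)\<leftarrow>?ps. \<Sum>(a', b')\<leftarrow>?ps. v a' * (u a * w (b * b')))"
    by (rule sum_list_pairs_swap)
  also have "\<dots> = (\<Sum>(a, b)\<leftarrow>?ps. \<Sum>(a', b')\<leftarrow>?ps. u a * v a' * w (b * b'))"
    by (simp only: mult.assoc mult.left_commute)
  finally show ?thesis
    unfolding r13_r23_def
    by (simp add: sum_list_pairs_apply ttensor_def trilinear_map_dual[OF d])
qed

text \<open>The product \<open>a' * b\<close> sits under \<open>v\<close>. Weighting
  \<open>b\<close> by \<open>u a\<close> makes it \<open>a'\<close> times r(u), and \<open>v\<close>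
  of that is \<open>Rstar\<close> at \<open>a'\<close>.\<close>

lemma r23_r12_pairing:
  assumes d: "u \<in> dual_space scale" "v \<in> dual_space scale" "w \<in> dual_space scale"
  shows "r23_r12 scale r (\<lambda>a b c. u a * v b * w c) =
    w (tensor_map scale r (Rstar (tensor_map scale r u) v))"
proof -
  let ?ps = "tensor_repr scale r"
  have "w (tensor_map scale r (Rstar (tensor_map scale r u) v))
      = (\<Sum>(a', b')\<leftarrow>?ps. \<Sum>(a, b)\<leftarrow>?ps. u a * v (a' * b) * w b')"
    unfolding tensor_map_def Rstar_def sum_scale_mult
    by (simp add: dualD[OF d(3)] dualD[OF d(2)] sum_list_pairs_const_mult)
  also have "\<dots> = (\<Sum>(a, b)\<leftarrow>?ps. \<Sum>(a', b')\<leftarrow>?ps. u a * v (a' * b) * w b')"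
    by (rule sum_list_pairs_swap)
  finally show ?thesis
    unfolding r23_r12_def
    by (simp add: sum_list_pairs_apply ttensor_def trilinear_map_dual[OF d])
qed

text \<open>The product \<open>a * a'\<close> sits under \<open>u\<close>. Here \<open>a\<close> is
  weighted by \<open>v b\<close>, which assembles the transpose at \<open>v\<close> as the left
  factor; hence \<open>Lstar\<close>.\<close>

lemma r12_r13_pairing:
  assumes d: "u \<in> dual_space scale" "v \<in> dual_space scale" "w \<in> dual_space scale"
  shows "r12_r13 scale r (\<lambda>a b c. u a * v b * w c) =
    w (tensor_map scale r (Lstar u (tensor_map_t scale r v)))"
proof -
  let ?ps = "tensor_repr scale r"
  have "w (tensor_map scale r (Lstar u (tensor_map_t scale r v)))
      = (\<Sum>(a', b')\<leftarrow>?ps. \<Sum>(a, b)\<leftarrow>?ps. v b * u (a * a') * w b')"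
    unfolding tensor_map_def tensor_map_t_def Lstar_def sum_scale_mult
    by (simp add: dualD[OF d(3)] dualD[OF d(1)] sum_list_pairs_const_mult)
  also have "\<dots> = (\<Sum>(a, b)\<leftarrow>?ps. \<Sum>(a', b')\<leftarrow>?ps. v b * u (a * a') * w b')"
    by (rule sum_list_pairs_swap)
  also have "\<dots> = (\<Sum>(a, b)\<leftarrow>?ps. \<Sum>(a', b')\<leftarrow>?ps. u (a * a') * v b * w b')"
    by (simp only: mult.commute)
  finally show ?thesis
    unfolding r12_r13_def
    by (simp add: sum_list_pairs_apply ttensor_def trilinear_map_dual[OF d])
qed

text \<open>The coordinate functionals of \<open>Basis\<close> are dual elements, and every
  trilinear form is a finite combination of their triple products.\<close>

lemma tensor_cube_eqI:
  assumes fin: "finite_dimensional_vector_space scale Basis"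
    and X: "X \<in> tensor_cube scale" and Y: "Y \<in> tensor_cube scale"
    and eq: "\<And>u v w. u \<in> dual_space scale \<Longrightarrow> v \<in> dual_space scale \<Longrightarrow> w \<in> dual_space scale \<Longrightarrow>
      X (\<lambda>a b c. u a * v b * w c) = Y (\<lambda>a b c. u a * v b * w c)"
  shows "X = Y"
proof (rule ext)
  fix T
  interpret fd: finite_dimensional_vector_space scale Basis by (rule fin)
  interpret F: vector_space "fun_scale :: 'k \<Rightarrow> _ \<Rightarrow> ('a, 'k) tensor3" by (rule vector_space_fun_scale)
  define \<delta> where "\<delta> e a = representation Basis a e" for e a
  have \<delta>: "\<delta> e \<in> dual_space scale" for e
    by (rule dual_spaceI)
      (simp_all add: \<delta>_def representation_add representation_scale fd.independent_Basis fd.span_Basis)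
  have expand: "a = (\<Sum>e\<in>Basis. scale (\<delta> e a) e)" for a
    unfolding \<delta>_def
    by (rule sum_representation_eq[symmetric])
      (simp_all add: fd.independent_Basis fd.span_Basis fd.finite_Basis)
  have lin: "g a = (\<Sum>e\<in>Basis. \<delta> e a * g e)" if "Vector_Spaces.linear scale (*) g" for g a
  proof -
    interpret g: Vector_Spaces.linear scale "(*)" g by fact
    have "g a = g (\<Sum>e\<in>Basis. scale (\<delta> e a) e)" using expand[of a] by simp
    then show ?thesis by (simp add: g.sum g.scale)
  qed
  define P where "P e f g = (\<lambda>a b c. \<delta> e a * \<delta> f b * \<delta> g c)" for e f g
  \<comment> \<open>Both sides are linear in \<open>Z\<close>, so induction over the span reduces
    this to a pure tensor, where \<open>T\<close> is expanded one slot at a time.\<close>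
  have tri: "Z T = (\<Sum>e\<in>Basis. \<Sum>f\<in>Basis. \<Sum>g\<in>Basis. T e f g * Z (P e f g))"
    if T: "trilinear_map scale (*) T" and Z: "Z \<in> tensor_cube scale" for Z
    using Z unfolding tensor_cube_def
  proof (induction rule: F.span_induct_alt)
    case base
    show ?case by simp
  next
    case (step k Z1 Z2)
    then obtain a b c where Z1: "Z1 = ttensor scale a b c" by blast
    have e1: "T a b c = (\<Sum>e\<in>Basis. \<delta> e a * T e b c)"
      and e2: "T a b c = (\<Sum>f\<in>Basis. \<delta> f b * T a f c)"
      and e3: "T a b c = (\<Sum>g\<in>Basis. \<delta> g c * T a b g)" for a b c
      using T lin[of "\<lambda>a. T a b c" a] lin[of "\<lambda>b. T a b c" b] lin[of "\<lambda>c. T a b c" c]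
      by (simp_all add: trilinear_map_def)
    have Z1P: "Z1 (P e f g) = \<delta> e a * \<delta> f b * \<delta> g c" for e f g
      by (simp add: Z1 P_def ttensor_def trilinear_map_dual \<delta>)
    have "T a b c = (\<Sum>e\<in>Basis. \<delta> e a * (\<Sum>f\<in>Basis. \<delta> f b * (\<Sum>g\<in>Basis. \<delta> g c * T e f g)))"
      unfolding e1[of a b c] unfolding e2[of _ b c] unfolding e3[of _ _ c] ..
    then have "Z1 T = (\<Sum>e\<in>Basis. \<Sum>f\<in>Basis. \<Sum>g\<in>Basis. T e f g * Z1 (P e f g))"
      by (simp add: Z1P sum_distrib_left mult_ac) (simp add: Z1 ttensor_def T)
    with step show ?case
      by (simp add: fun_scale_def sum.distrib sum_distrib_left distrib_left mult.left_commute)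
  qed
  \<comment> \<open>Tensors are functions on all \<open>T\<close>, so equality also concerns forms
    that are not trilinear; there \<open>ttensor\<close> has the default value 0.\<close>
  have nontri: "Z T = 0" if T: "\<not> trilinear_map scale (*) T" and Z: "Z \<in> tensor_cube scale" for Z
    using Z unfolding tensor_cube_def
    by (induction rule: F.span_induct_alt) (use T in \<open>auto simp: fun_scale_def ttensor_def\<close>)
  show "X T = Y T"
    by (cases "trilinear_map scale (*) T")
      (simp_all add: tri[OF _ X] tri[OF _ Y] nontri[OF _ X] nontri[OF _ Y] eq \<delta> P_def)
qed

section \<open>Yang-Baxter equations as operator identities\<close>

lemma tensor_cube_subspace: "module.subspace fun_scale (tensor_cube scale)"
proof -
  interpret F: vector_space "fun_scale :: 'k \<Rightarrow> _ \<Rightarrow> ('a, 'k) tensor3" by (rule vector_space_fun_scale)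
  show ?thesis unfolding tensor_cube_def by (rule F.subspace_span)
qed

text \<open>By the pairing lemmas, each side of the tensor equation pairs to \<open>w\<close> of the
  corresponding side of the operator identity. A separate \<open>s\<close> serves both equations:
  \<epsilon> = 0 gives the AYBE, and \<open>s = r + flip scale r\<close> the extended one.\<close>

lemma yang_baxter_iff:
  assumes fin: "finite_dimensional_vector_space scale Basis"
  shows "r12_r13 scale r + r13_r23 scale r - r23_r12 scale r = fun_scale \<epsilon> (r13_r23 scale s) \<longleftrightarrow>
    (\<forall>u\<in>dual_space scale. \<forall>v\<in>dual_space scale.
      tensor_map scale r u * tensor_map scale r v -
      tensor_map scale r (Rstar (tensor_map scale r u) v - Lstar u (tensor_map_t scale r v)) =
      scale \<epsilon> (tensor_map scale s u * tensor_map scale s v))"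
    (is "?X = ?Y \<longleftrightarrow> (\<forall>u\<in>_. \<forall>v\<in>_. ?f u v = ?g u v)")
proof -
  interpret F: vector_space "fun_scale :: 'k \<Rightarrow> _ \<Rightarrow> ('a, 'k) tensor3" by (rule vector_space_fun_scale)
  have mem: "r12_r13 scale t \<in> tensor_cube scale" "r13_r23 scale t \<in> tensor_cube scale"
    "r23_r12 scale t \<in> tensor_cube scale" for t
    unfolding r12_r13_def r13_r23_def r23_r12_def by (rule sum_ttensor_in_tensor_cube)+
  have X: "?X \<in> tensor_cube scale" and Y: "?Y \<in> tensor_cube scale"
    by (intro F.subspace_add F.subspace_diff F.subspace_scale tensor_cube_subspace mem)+
  have pX: "?X (\<lambda>a b c. u a * v b * w c) = w (?f u v)"
    and pY: "?Y (\<lambda>a b c. u a * v b * w c) = w (?g u v)"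
    if d: "u \<in> dual_space scale" "v \<in> dual_space scale" "w \<in> dual_space scale" for u v w
    by (simp_all add: r12_r13_pairing[OF d] r13_r23_pairing[OF d] r23_r12_pairing[OF d]
        dualD[OF d(3)] tensor_map_diff fun_scale_def)
  show ?thesis
  proof
    assume "?X = ?Y"
    then show "\<forall>u\<in>dual_space scale. \<forall>v\<in>dual_space scale. ?f u v = ?g u v"
      using pX pY by (metis dual_separates)
  next
    assume "\<forall>u\<in>dual_space scale. \<forall>v\<in>dual_space scale. ?f u v = ?g u v"
    then show "?X = ?Y"
      using pX pY by (intro tensor_cube_eqI[OF fin X Y]) auto
  qed
qed

lemma AYBE_iff:
  assumes "finite_dimensional_vector_space scale Basis"
  shows "AYBE scale r \<longleftrightarrow>
    (\<forall>u\<in>dual_space scale. \<forall>v\<in>dual_space scale.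
      tensor_map scale r u * tensor_map scale r v =
      tensor_map scale r (Rstar (tensor_map scale r u) v - Lstar u (tensor_map_t scale r v)))"
proof -
  have "fun_scale 0 (r13_r23 scale r) = 0" by (simp add: fun_scale_def fun_eq_iff)
  with yang_baxter_iff[OF assms, of r 0 r] show ?thesis by (simp add: AYBE_def)
qed

section \<open>Invariant tensors and extended O-operators\<close>

lemma invariant_tensor_map:
  assumes s: "s \<in> tensor_square scale" and inv: "invariant_tensor scale s"
    and d: "u \<in> dual_space scale"
  shows "tensor_map scale s (Rstar x u) = x * tensor_map scale s u"
    and "tensor_map_t scale s (Lstar u x) = tensor_map_t scale s u * x"
proof -
  let ?ps = "tensor_repr scale s"
  \<comment> \<open>This is the invariance condition evaluated at the bilinear form
    \<open>\<lambda>a b. v a * w b\<close>.\<close>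
  have pair: "(\<Sum>(a, b)\<leftarrow>?ps. v a * w (x * b)) = (\<Sum>(a, b)\<leftarrow>?ps. v (a * x) * w b)"
    if vw: "v \<in> dual_space scale" "w \<in> dual_space scale" for v w
  proof -
    have B: "bilinear_map scale (*) (\<lambda>a b. v a * w b)"
      using vector_space_axioms vector_space_times vw
      by (simp add: bilinear_map_def Vector_Spaces.linear_iff dualD algebra_simps)
    have "(\<Sum>(a, b)\<leftarrow>ps. tensor scale a (x * b) - tensor scale (a * x) b) (\<lambda>a b. v a * w b)
        = (\<Sum>(a, b)\<leftarrow>ps. v a * w (x * b)) - (\<Sum>(a, b)\<leftarrow>ps. v (a * x) * w b)" for ps
      using B by (induction ps) (auto simp: tensor_def)
    from this[of ?ps] inv show ?thesis by (simp add: invariant_tensor_def)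
  qed
  show "tensor_map scale s (Rstar x u) = x * tensor_map scale s u"
  proof (rule dual_separates)
    fix w assume w: "w \<in> dual_space scale"
    show "w (tensor_map scale s (Rstar x u)) = w (x * tensor_map scale s u)"
      by (simp add: tensor_map_def Rstar_def sum_scale_mult dualD[OF w] pair[OF d w])
  qed
  \<comment> \<open>The same pairing with the roles exchanged: the test functional \<open>w\<close>
    takes the first slot and \<open>u\<close> the second.\<close>
  show "tensor_map_t scale s (Lstar u x) = tensor_map_t scale s u * x"
  proof (rule dual_separates)
    fix w assume w: "w \<in> dual_space scale"
    show "w (tensor_map_t scale s (Lstar u x)) = w (tensor_map_t scale s u * x)"
      using pair[OF w d] by (simp add: tensor_map_t_def Lstar_def sum_scale_mult dualD[OF w] mult.commute)
  qed
qed

text \<open>Both sides are the value of \<open>s\<close> at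
  \<open>\<lambda>a b. u a * v b\<close>.\<close>

lemma tensor_map_transpose:
  assumes "s \<in> tensor_square scale" "u \<in> dual_space scale" "v \<in> dual_space scale"
  shows "v (tensor_map scale s u) = u (tensor_map_t scale s v)"
  using tensor_map_pairing[OF assms] by simp

lemma extended_AYBE_iff:
  assumes fin: "finite_dimensional_vector_space scale Basis"
    and two: "(2::'k) \<noteq> 0" and r: "r \<in> tensor_square scale"
  defines "\<alpha> \<equiv> tensor_map scale (fun_scale (1 / 2) (r - flip scale r))"
    and "\<beta> \<equiv> tensor_map scale (fun_scale (1 / 2) (r + flip scale r))"
  assumes inv: "invariant_tensor scale (fun_scale (1 / 2) (r + flip scale r))"
  shows "extended_AYBE scale ((\<kappa> + 1) / 4) r \<longleftrightarrow> extended_O_operator scale \<alpha> \<beta> \<kappa>"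
proof -
  interpret F: vector_space "fun_scale :: 'k \<Rightarrow> _ \<Rightarrow> ('a, 'k) tensor2" by (rule vector_space_fun_scale)
  let ?s = "fun_scale (1 / 2) (r + flip scale r)"
  have s: "?s \<in> tensor_square scale"
    using r flip_in_tensor_square[of r] unfolding tensor_square_def
    by (intro F.span_scale F.span_add)
  have four: "(4::'k) \<noteq> 0"
    using two by (metis mult_eq_0_iff mult_2 numeral_Bit0)
  have half: "scale (1 / 2) x + scale (1 / 2) x = x" for x
    using two by (simp flip: scale_left_distrib)
  have \<alpha>: "\<alpha> u = scale (1 / 2) (tensor_map scale r u - tensor_map_t scale r u)"
    and \<beta>: "\<beta> u = scale (1 / 2) (tensor_map scale r u + tensor_map_t scale r u)"
    and sum: "tensor_map scale (r + flip scale r) u = tensor_map scale r u + tensor_map_t scale r u"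
    if "u \<in> dual_space scale" for u
    unfolding \<alpha>_def \<beta>_def
    using tensor_map_symmetric_part[OF r that, of "1 / 2"] tensor_map_symmetric_part(1)[OF r that, of 1]
    by (simp_all only: F.scale_one scale_one)
  have r_eq: "tensor_map scale r u = \<alpha> u + \<beta> u" and rt_eq: "tensor_map_t scale r u = \<beta> u - \<alpha> u"
    and sum_eq: "tensor_map scale (r + flip scale r) u = \<beta> u + \<beta> u"
    if "u \<in> dual_space scale" for u
    using half[of "tensor_map scale r u"] half[of "tensor_map_t scale r u"]
    by (simp_all add: \<alpha>[OF that] \<beta>[OF that] sum[OF that] scale_right_distrib scale_right_diff_distrib algebra_simps)
  \<comment> \<open>The symmetric part equals its own transpose, so the transposed half of the
    invariance lemma also speaks about \<beta>.\<close>
  have \<beta>_t: "tensor_map_t scale ?s u = \<beta> u" if u: "u \<in> dual_space scale" for u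
  proof (rule dual_separates)
    fix v assume v: "v \<in> dual_space scale"
    have "v (tensor_map_t scale ?s u) = u (\<beta> v)"
      unfolding \<beta>_def by (rule tensor_map_transpose[OF s v u, symmetric])
    also have "\<dots> = v (\<beta> u)"
      using tensor_map_transpose[OF r u v] tensor_map_transpose[OF r v u]
      by (simp add: \<beta> u v dualD[OF u] dualD[OF v])
    finally show "v (tensor_map_t scale ?s u) = v (\<beta> u)" .
  qed
  have \<beta>R: "\<beta> (Rstar x u) = x * \<beta> u" and \<beta>L: "\<beta> (Lstar u x) = \<beta> u * x"
    if u: "u \<in> dual_space scale" for u x
    using invariant_tensor_map[OF s inv u, of x] by (simp_all add: \<beta>_t u Lstar_dual \<beta>_def[symmetric])
  \<comment> \<open>Evaluate \<open>v (\<beta> (Rstar y u))\<close> twice: the homomorphism property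
    gives \<open>v (y * \<beta> u)\<close>, transposition gives
    \<open>u (\<beta> v * y)\<close>.\<close>
  have RL: "Rstar (\<beta> u) v = Lstar u (\<beta> v)" if u: "u \<in> dual_space scale" and v: "v \<in> dual_space scale" for u v
  proof
    fix y
    have "v (\<beta> (Rstar y u)) = (Rstar y u) (tensor_map_t scale ?s v)"
      unfolding \<beta>_def by (rule tensor_map_transpose[OF s Rstar_dual[OF u] v])
    then show "Rstar (\<beta> u) v y = Lstar u (\<beta> v) y"
      by (simp add: \<beta>R u \<beta>_t v) (simp add: Rstar_def Lstar_def)
  qed
  have key: "tensor_map scale r u * tensor_map scale r v -
        tensor_map scale r (Rstar (tensor_map scale r u) v - Lstar u (tensor_map_t scale r v)) =
      \<alpha> u * \<alpha> v - \<alpha> (Rstar (\<alpha> u) v + Lstar u (\<alpha> v)) + \<beta> u * \<beta> v"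
    if u: "u \<in> dual_space scale" and v: "v \<in> dual_space scale" for u v
  proof -
    \<comment> \<open>With r = \<alpha> + \<beta> and transpose \<beta> - \<alpha>, the \<beta>
      terms of the argument cancel by \<open>RL\<close>.\<close>
    have "Rstar (tensor_map scale r u) v - Lstar u (tensor_map_t scale r v) = Rstar (\<alpha> u) v + Lstar u (\<alpha> v)"
      using RL[OF u v] by (simp add: r_eq[OF u] rt_eq[OF v] fun_eq_iff Rstar_def Lstar_def
          dualD[OF u] dualD[OF v] algebra_simps)
    \<comment> \<open>The bimodule property of \<beta> produces exactly the mixed terms of r(u) *
      r(v), which therefore cancel and leave \<open>\<beta> u * \<beta> v\<close>.\<close>
    moreover have "tensor_map scale r (Rstar (\<alpha> u) v + Lstar u (\<alpha> v)) =
        \<alpha> (Rstar (\<alpha> u) v + Lstar u (\<alpha> v)) + \<alpha> u * \<beta> v + \<beta> u * \<alpha> v"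
      by (simp add: tensor_map_add r_eq Rstar_dual Lstar_dual u v \<beta>R \<beta>L)
        (simp add: \<alpha>_def tensor_map_add algebra_simps)
    ultimately show ?thesis by (simp add: r_eq u v algebra_simps)
  qed
  \<comment> \<open>Doubling both factors yields four copies, which absorb the denominator; the 1 in
    \<kappa> + 1 accounts for the extra \<open>\<beta> u * \<beta> v\<close> in
    \<open>key\<close>.\<close>
  have rhs: "scale ((\<kappa> + 1) / 4) ((\<beta> u + \<beta> u) * (\<beta> v + \<beta> v)) = scale \<kappa> (\<beta> u * \<beta> v) + \<beta> u * \<beta> v" for u v
  proof -
    let ?x = "\<beta> u * \<beta> v" and ?c = "(\<kappa> + 1) / 4"
    have "scale ?c ((\<beta> u + \<beta> u) * (\<beta> v + \<beta> v)) = scale (?c + ?c + ?c + ?c) ?x"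
      by (simp only: scale_left_distrib scale_right_distrib distrib_left distrib_right add.assoc)
    also have "?c + ?c + ?c + ?c = \<kappa> + 1"
      using four by (simp flip: add_divide_distrib add: divide_eq_eq algebra_simps)
    finally show ?thesis by (simp add: scale_left_distrib)
  qed
  \<comment> \<open>The extended right-hand tensor is by definition \<open>r13_r23\<close> of
    \<open>r + flip scale r\<close>, whose map is 2\<beta>.\<close>
  have "extended_AYBE scale ((\<kappa> + 1) / 4) r \<longleftrightarrow>
      r12_r13 scale r + r13_r23 scale r - r23_r12 scale r =
      fun_scale ((\<kappa> + 1) / 4) (r13_r23 scale (r + flip scale r))"
    by (simp add: extended_AYBE_def r13_r31_r23_r32_def r13_r23_def)
  then show ?thesis
    unfolding yang_baxter_iff[OF fin] extended_O_operator_def by (simp add: key sum_eq rhs)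
qed

end

theorem theorem3p5:
  fixes scale :: "'k::field \<Rightarrow> 'a::ring \<Rightarrow> 'a"
    and r :: "('a, 'k) tensor2"
  assumes "assoc_algebra scale"
    and "finite_dimensional_vector_space scale Basis"
    and "CHAR('k) \<noteq> 2"
    and "r \<in> tensor_square scale"
  shows
    "(AYBE scale r \<longleftrightarrow>
       (\<forall>u\<in>dual_space scale. \<forall>v\<in>dual_space scale.
          tensor_map scale r u * tensor_map scale r v =
          tensor_map scale r
            (Rstar (tensor_map scale r u) v - Lstar u (tensor_map_t scale r v))))
     \<and>
     (let \<alpha> = fun_scale (1 / 2) (r - flip scale r);
          \<beta> = fun_scale (1 / 2) (r + flip scale r)
      in invariant_tensor scale \<beta> \<longrightarrow>
         (\<forall>\<kappa>. extended_AYBE scale ((\<kappa> + 1) / 4) r \<longleftrightarrow>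
            extended_O_operator scale (tensor_map scale \<alpha>) (tensor_map scale \<beta>) \<kappa>))"
proof -
  interpret assoc_algebra scale by fact
  \<comment> \<open>In a field 2 vanishes iff the characteristic divides 2; a divisor of 2 is 1 or
    2, and 1 is never a characteristic here.\<close>
  have "\<not> CHAR('k) dvd 2"
  proof
    assume "CHAR('k) dvd 2"
    then have "CHAR('k) \<le> 2" by (simp add: dvd_imp_le)
    moreover have "CHAR('k) \<noteq> 0" using \<open>CHAR('k) dvd 2\<close> by (metis dvd_0_left_iff zero_neq_numeral)
    ultimately show False using assms(3) CHAR_not_1[where ?'a = 'k] by linarith
  qed
  then have two: "(2::'k) \<noteq> 0"
    using of_nat_eq_0_iff_char_dvd[of 2, where ?'a = 'k] by simp
  show ?thesis
    using AYBE_iff[OF assms(2)] extended_AYBE_iff[OF assms(2) two assms(4)] by (simp add: Let_def)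
qed

end
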